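(* Let $\mathbb{F}$ be a field, let $n\ge 1$ and $r\ge 0$ be integers, and let $f\in\mathbb{F}[x_1,x_2,\dots,x_n]$ be a polynomial of (total) degree $d$. Suppose that $f(x)=0$ for every vertex $x\in\{0,1\}^n\subset\mathbb{F}^n$ of the unit cube of weight greater than $r$, and that $f(x)\neq 0$ for every vertex $x\in\{0,1\}^n$ of weight at most $r$. Then $d\ge n-r$.
   Context: The unit cube is the set $\{0,1\}^n$ regarded as a subset of the vector space $\mathbb{F}^n$, and its elements are called vertices. The weight of a vector in $\mathbb{F}^n$ is the number of its nonzero coordinates. *)

theory Defs
  imports "HOL-Library.Poly_Mapping" "HOL-Library.FuncSet"
begin

text \<open>
  A monomial is a finitely supported map from variable indices to exponents, and a polynomial a
  finitely supported map from monomials to coefficients. The ring structure is the one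
  of \<^theory>\<open>HOL-Library.Poly_Mapping\<close>: addition of monomials is addition of exponents, and
  multiplication of polynomials is convolution.
\<close>

type_synonym monom = "nat \<Rightarrow>\<^sub>0 nat"
type_synonym 'a mpoly = "monom \<Rightarrow>\<^sub>0 'a"

text \<open>The polynomials in the variables with indices $1, \dots, n$.\<close>

definition mpolys :: "nat \<Rightarrow> 'a::zero mpoly set" where
  "mpolys n = {f. \<forall>m \<in> Poly_Mapping.keys f. Poly_Mapping.keys m \<subseteq> {1..n}}"

definition monom_degree :: "monom \<Rightarrow> nat" where
  "monom_degree m = (\<Sum>i\<in>Poly_Mapping.keys m. Poly_Mapping.lookup m i)"

text \<open>The insertion of \<open>0\<close> only matters for the zero polynomial, which gets degree \<open>0\<close>.\<close>

definition total_degree :: "'a::zero mpoly \<Rightarrow> nat" where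
  "total_degree f = Max (insert 0 (monom_degree ` Poly_Mapping.keys f))"

definition mpoly_eval :: "'a::comm_semiring_1 mpoly \<Rightarrow> (nat \<Rightarrow> 'a) \<Rightarrow> 'a" where
  "mpoly_eval f x =
    (\<Sum>m\<in>Poly_Mapping.keys f. Poly_Mapping.lookup f m *
      (\<Prod>i\<in>Poly_Mapping.keys m. x i ^ Poly_Mapping.lookup m i))"

text \<open>
  Vectors of the \<open>n\<close>-dimensional coordinate space are the elements of
  \<open>{1..n} \<rightarrow>\<^sub>E UNIV\<close>: functions whose values outside \<open>{1..n}\<close> are fixed to \<open>undefined\<close>.
\<close>

definition unit_cube :: "nat \<Rightarrow> (nat \<Rightarrow> 'a::zero_neq_one) set" where
  "unit_cube n = {1..n} \<rightarrow>\<^sub>E {0, 1}"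

definition weight :: "nat \<Rightarrow> (nat \<Rightarrow> 'a::zero) \<Rightarrow> nat" where
  "weight n x = card {i \<in> {1..n}. x i \<noteq> 0}"

end

theory Submission
  imports Defs
begin

text \<open>
  If $d + r < n$, restrict \<open>f\<close> to the subcube on which the first $r$ coordinates are $1$: the only
  vertex of weight at most $r$ there is the one with support $\{1,\dots,r\}$, so the sum of
  $(-1)^{|x|} f(x)$ over this subcube is $\pm f$ at that vertex and hence nonzero. On the other hand, a
  monomial with support $K$ contributes the sum of $(-1)^{|T|}$ over all $T$ between
  $\{1,\dots,r\} \cup K$ and $\{1,\dots,n\}$. As the lower set has at most $r + d < n$ elements,
  each contribution vanishes.
\<close>

text \<open>The restriction to \<open>{1..n}\<close> makes the point extensional, as membership in
  \<open>unit_cube n\<close> demands.\<close>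

definition vertex :: "nat \<Rightarrow> nat set \<Rightarrow> nat \<Rightarrow> 'a::zero_neq_one" where
  "vertex n T = (\<lambda>i\<in>{1..n}. if i \<in> T then 1 else 0)"

lemma vertex_in_unit_cube: "vertex n T \<in> unit_cube n"
  by (auto simp: vertex_def unit_cube_def)

lemma weight_vertex:
  assumes "T \<subseteq> {1..n}"
  shows "weight n (vertex n T :: nat \<Rightarrow> 'a::zero_neq_one) = card T"
proof -
  have "{i \<in> {1..n}. (vertex n T :: nat \<Rightarrow> 'a) i \<noteq> 0} = T"
    using assms by (auto simp: vertex_def)
  then show ?thesis by (simp add: weight_def)
qed

text \<open>Exponents on the support of a monomial are positive, so at a 0/1 point each power equals
  its base, and the monomial takes the value 1 exactly when none of its variables is 0. Membership
  in \<open>mpolys n\<close> keeps the \<open>undefined\<close> coordinates out of the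
  product.\<close>

lemma mpoly_eval_vertex:
  fixes f :: "'a::field mpoly"
  assumes "f \<in> mpolys n"
  shows "mpoly_eval f (vertex n T) =
    (\<Sum>m\<in>Poly_Mapping.keys f. Poly_Mapping.lookup f m * of_bool (Poly_Mapping.keys m \<subseteq> T))"
  unfolding mpoly_eval_def
proof (intro sum.cong refl arg_cong2[where f = "(*)"])
  fix m assume m: "m \<in> Poly_Mapping.keys f"
  then have K: "Poly_Mapping.keys m \<subseteq> {1..n}"
    using assms by (auto simp: mpolys_def)
  have "(\<Prod>i\<in>Poly_Mapping.keys m. (vertex n T i :: 'a) ^ Poly_Mapping.lookup m i) =
    (\<Prod>i\<in>Poly_Mapping.keys m. of_bool (i \<in> T))"
    using K by (intro prod.cong) (auto simp: vertex_def in_keys_iff subset_iff)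
  also have "\<dots> = of_bool (Poly_Mapping.keys m \<subseteq> T)"
    by (auto simp: subset_iff of_bool_def intro!: prod.neutral)
  finally show "(\<Prod>i\<in>Poly_Mapping.keys m. vertex n T i ^ Poly_Mapping.lookup m i) =
    (of_bool (Poly_Mapping.keys m \<subseteq> T) :: 'a)" .
qed

lemma card_keys_le_monom_degree: "card (Poly_Mapping.keys m) \<le> monom_degree m"
proof -
  have "card (Poly_Mapping.keys m) = (\<Sum>i\<in>Poly_Mapping.keys m. 1)" by simp
  also have "\<dots> \<le> monom_degree m"
    unfolding monom_degree_def by (intro sum_mono) (auto simp: in_keys_iff Suc_le_eq)
  finally show ?thesis .
qed

lemma monom_degree_le_total_degree:
  "m \<in> Poly_Mapping.keys f \<Longrightarrow> monom_degree m \<le> total_degree f"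
  unfolding total_degree_def by (intro Max_ge) auto

text \<open>Toggling a fixed element of \<open>N - M\<close> pairs the even sets with the odd ones.
  Properness matters: for \<open>M = N\<close> a single sign would remain.\<close>

lemma sum_alternating_supersets:
  assumes "finite N" "M \<subset> N"
  shows "(\<Sum>T | M \<subseteq> T \<and> T \<subseteq> N. (- 1) ^ card T) = (0 :: 'a::ring_1)"
proof (rule sum_alternating_cancels)
  show "finite {T. M \<subseteq> T \<and> T \<subseteq> N}"
    using assms(1) by (rule finite_subset[rotated, OF finite_Pow_iff[THEN iffD2]]) auto
  show "card {T. T \<in> {T. M \<subseteq> T \<and> T \<subseteq> N} \<and> even (card T)} =
    card {T. T \<in> {T. M \<subseteq> T \<and> T \<subseteq> N} \<and> odd (card T)}"
    using card_subsupersets_even_odd[OF assms] by (simp add: conj_ac)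
qed

lemma sum_alternating_mpoly_eval_eq_0:
  fixes f :: "'a::field mpoly"
  assumes f: "f \<in> mpolys n" and S: "S \<subseteq> {1..n}" and less: "card S + total_degree f < n"
  shows "(\<Sum>T | S \<subseteq> T \<and> T \<subseteq> {1..n}. (- 1) ^ card T * mpoly_eval f (vertex n T)) = 0"
proof -
  let ?I = "{T. S \<subseteq> T \<and> T \<subseteq> {1..n}}"
  have fin: "finite ?I"
    by (rule finite_subset[of _ "Pow {1..n}"]) auto
  have "(\<Sum>T\<in>?I. (- 1) ^ card T * of_bool (Poly_Mapping.keys m \<subseteq> T)) = (0 :: 'a)"
    if m: "m \<in> Poly_Mapping.keys f" for m
  proof -
    let ?M = "S \<union> Poly_Mapping.keys m"
    have "card ?M \<le> card S + card (Poly_Mapping.keys m)"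
      by (rule card_Un_le)
    also have "\<dots> < n"
      using less card_keys_le_monom_degree[of m] monom_degree_le_total_degree[OF m] by linarith
    finally have "?M \<noteq> {1..n}" by auto
    moreover have "?M \<subseteq> {1..n}"
      using f m S by (auto simp: mpolys_def)
    ultimately have "?M \<subset> {1..n}" by blast
    then have "(\<Sum>T | ?M \<subseteq> T \<and> T \<subseteq> {1..n}. (- 1) ^ card T) = (0 :: 'a)"
      by (intro sum_alternating_supersets) auto
    \<comment> \<open>The indicator discards every \<open>T\<close> in \<open>?I\<close> that misses
      a variable of \<open>m\<close>; the others are precisely the sets between \<open>?M\<close>
      and \<open>{1..n}\<close>.\<close>
    moreover have "(\<Sum>T\<in>?I. (- 1) ^ card T * of_bool (Poly_Mapping.keys m \<subseteq> T)) =
      (\<Sum>T | ?M \<subseteq> T \<and> T \<subseteq> {1..n}. (- 1) ^ card T :: 'a)"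
      by (rule sum.mono_neutral_cong_right[OF fin]) auto
    ultimately show ?thesis by simp
  qed
  then have "(\<Sum>m\<in>Poly_Mapping.keys f. Poly_Mapping.lookup f m *
      (\<Sum>T\<in>?I. (- 1) ^ card T * of_bool (Poly_Mapping.keys m \<subseteq> T))) = 0"
    by simp
  \<comment> \<open>Exchanging the two sums isolates the contribution of each monomial.\<close>
  then show ?thesis
    unfolding mpoly_eval_vertex[OF f] sum_distrib_left
    by (subst sum.swap) (simp add: mult.left_commute)
qed

theorem theorem1:
  fixes f :: "'a::field mpoly" and n r d :: nat
  assumes "n \<ge> 1"
    and "f \<in> mpolys n"
    and "total_degree f = d"
    and "\<And>x. x \<in> unit_cube n \<Longrightarrow> weight n x > r \<Longrightarrow> mpoly_eval f x = 0"
    and "\<And>x. x \<in> unit_cube n \<Longrightarrow> weight n x \<le> r \<Longrightarrow> mpoly_eval f x \<noteq> 0"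
  shows "int d \<ge> int n - int r"
proof (rule ccontr)
  assume "\<not> ?thesis"
  \<comment> \<open>This also gives \<open>r < n\<close>, so that \<open>{1..r}\<close> fits inside
    \<open>{1..n}\<close>.\<close>
  then have less: "r + d < n" by linarith
  let ?S = "{1..r}"
  let ?I = "{T. ?S \<subseteq> T \<and> T \<subseteq> {1..n}}"
  let ?g = "\<lambda>T. (- 1) ^ card T * mpoly_eval f (vertex n T)"
  have S: "?S \<subseteq> {1..n}" using less by auto
  have fin: "finite ?I"
    by (rule finite_subset[of _ "Pow {1..n}"]) auto
  have zero: "?g T = 0" if "T \<in> ?I - {?S}" for T
  proof -
    have T: "T \<subseteq> {1..n}" "?S \<subset> T" using that by auto
    \<comment> \<open>Since \<open>card ?S = r\<close>, the vertex of \<open>T\<close> has weight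
      above \<open>r\<close>, where \<open>f\<close> vanishes.\<close>
    then have "card ?S < card T"
      by (intro psubset_card_mono finite_subset[OF T(1)]) auto
    then show ?thesis
      using assms(4)[OF vertex_in_unit_cube] weight_vertex[OF T(1), where ?'a = 'a] by simp
  qed
  have "sum ?g ?I = sum ?g {?S}"
    using zero S by (intro sum.mono_neutral_right fin) auto
  moreover have "sum ?g ?I = 0"
    using less assms(3) by (intro sum_alternating_mpoly_eval_eq_0 assms(2) S) auto
  ultimately have "mpoly_eval f (vertex n ?S) = 0" by simp
  \<comment> \<open>The weight here is exactly \<open>r\<close>, the largest at which
    \<open>f\<close> is assumed nonzero.\<close>
  moreover have "mpoly_eval f (vertex n ?S) \<noteq> 0"
    by (rule assms(5)[OF vertex_in_unit_cube]) (simp only: weight_vertex[OF S], simp)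
  ultimately show False by simp
qed

end
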